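(* Let $X$ be a compact metrizable space. Then $\mathrm{UPE}(X)$ is a Borel subset of $\mathrm{TDS}(X)$.
   Context: $\mathrm{TDS}(X)$ is the Polish space of all continuous maps $T:X\to X$ with the topology of the sup metric. For an open cover $\mathcal U$ of $X$ and $T\in\mathrm{TDS}(X)$, $h_{\mathrm{top}}(X,T,\mathcal U)=\lim_{n\to\infty}\frac1n\log N\left(\bigvee_{m=1}^nT^{-m}(\mathcal U)\right)$, where $N(\cdot)$ is the smallest cardinality of a subcover and $\mathcal U\vee\mathcal V=\{U\cap V:U\in\mathcal U,V\in\mathcal V\}$. $(X,T)$ has uniform positive entropy (UPE) if $h_{\mathrm{top}}(X,T,\mathcal U)>0$ for every open cover $\mathcal U=\{U,V\}$ of $X$ consisting of two non-dense open sets. Equivalently, every $(x_1,x_2)\in X^2$ is an independence entropy pair: for all open $A_1\ni x_1$, $A_2\ni x_2$ there is $I\subseteq\mathbb N$ with $\liminf_n|I\cap[1,n]|/n>0$ such that $\bigcap_{j\in J}T^{-j}(Y_j)\ne\emptyset$ for every finite $J\subseteq I$ and all $(Y_j)\in\prod_{j\in J}\{A_1,A_2\}$. $\mathrm{UPE}(X)=\{T\in\mathrm{TDS}(X):(X,T)\text{ has UPE}\}$. *)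

theory Defs
  imports "HOL-Analysis.Analysis"
begin

(* A self-map of the carrier of X is represented by its extensional representative,
   so that distinct elements of TDS X are distinct as maps on topspace X. *)
definition TDS :: "'a topology \<Rightarrow> ('a \<Rightarrow> 'a) set" where
  "TDS X = {T \<in> extensional (topspace X). continuous_map X X T}"

(* The topology of the sup metric, for a metric m inducing the topology of X. *)
definition TDS_topology :: "'a topology \<Rightarrow> 'a metric \<Rightarrow> ('a \<Rightarrow> 'a) topology" where
  "TDS_topology X m = mtopology_of (cfunspace X m)"

lemma topspace_TDS_topology:
  assumes "compact_space X" "mtopology_of m = X"
  shows "topspace (TDS_topology X m) = TDS X"
proof -
  interpret Metric_space "mspace m" "mdist m"
    by (rule Metric_space_mspace_mdist)
  have "mbounded (T ` topspace X)" if "continuous_map X X T" for T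
    using that assms compactin_imp_mbounded[of "T ` topspace X"]
      image_compactin[of X "topspace X" X T]
    by (simp add: compact_space_def mtopology_of_def)
  then show ?thesis
    using assms by (auto simp: TDS_topology_def TDS_def continuous_map_def)
qed

lemma mdist_TDS:
  assumes "compact_space X" "mtopology_of m = X" "topspace X \<noteq> {}" "S \<in> TDS X" "T \<in> TDS X"
  shows "mdist (cfunspace X m) S T = (SUP x\<in>topspace X. mdist m (S x) (T x))"
proof -
  interpret Metric_space "mspace m" "mdist m"
    by (rule Metric_space_mspace_mdist)
  have "TDS X = mspace (cfunspace X m)"
    using topspace_TDS_topology[OF assms(1,2)] by (simp add: TDS_topology_def)
  then have "S \<in> fspace (topspace X)" "T \<in> fspace (topspace X)"
    using assms(4,5) by (auto simp: fspace_def)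
  then show ?thesis
    using assms(3) by (simp add: mdist_cfunspace_eq_mdist_funspace fdist_def)
qed

definition borel_of :: "'b topology \<Rightarrow> 'b measure" where
  "borel_of Y = sigma (topspace Y) {U. openin Y U}"

definition open_cover :: "'a topology \<Rightarrow> 'a set set \<Rightarrow> bool" where
  "open_cover X \<U> \<longleftrightarrow> (\<forall>U\<in>\<U>. openin X U) \<and> \<Union>\<U> = topspace X"

definition cover_join :: "'a set set \<Rightarrow> 'a set set \<Rightarrow> 'a set set" where
  "cover_join \<U> \<V> = {U \<inter> V | U V. U \<in> \<U> \<and> V \<in> \<V>}"

(* The cover consisting of the sets T^{-m}(U). *)
definition cover_preimage ::
  "'a topology \<Rightarrow> ('a \<Rightarrow> 'a) \<Rightarrow> nat \<Rightarrow> 'a set set \<Rightarrow> 'a set set" where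
  "cover_preimage X T m \<U> = (\<lambda>U. {x \<in> topspace X. (T ^^ m) x \<in> U}) ` \<U>"

(* The join of T^{-1}\<U>, ..., T^{-n}\<U>; the trivial cover {X} is neutral for the join. *)
primrec cover_iterate ::
  "'a topology \<Rightarrow> ('a \<Rightarrow> 'a) \<Rightarrow> 'a set set \<Rightarrow> nat \<Rightarrow> 'a set set" where
  "cover_iterate X T \<U> 0 = {topspace X}"
| "cover_iterate X T \<U> (Suc n) =
     cover_join (cover_iterate X T \<U> n) (cover_preimage X T (Suc n) \<U>)"

(* The finiteness requirement excludes infinite subcovers, whose card would be 0. *)
definition min_subcover_card :: "'a topology \<Rightarrow> 'a set set \<Rightarrow> nat" where
  "min_subcover_card X \<U> =
     (LEAST k. \<exists>\<V>. \<V> \<subseteq> \<U> \<and> finite \<V> \<and> \<Union>\<V> = topspace X \<and> card \<V> = k)"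

definition h_top :: "'a topology \<Rightarrow> ('a \<Rightarrow> 'a) \<Rightarrow> 'a set set \<Rightarrow> real" where
  "h_top X T \<U> = lim (\<lambda>n. ln (real (min_subcover_card X (cover_iterate X T \<U> n))) / real n)"

definition has_UPE :: "'a topology \<Rightarrow> ('a \<Rightarrow> 'a) \<Rightarrow> bool" where
  "has_UPE X T \<longleftrightarrow>
     (\<forall>U V. open_cover X {U, V} \<and> X closure_of U \<noteq> topspace X \<and> X closure_of V \<noteq> topspace X
        \<longrightarrow> h_top X T {U, V} > 0)"

definition UPE :: "'a topology \<Rightarrow> ('a \<Rightarrow> 'a) set" where
  "UPE X = {T \<in> TDS X. has_UPE X T}"

end

theory Submission
  imports Defs
begin

text \<open>
  The set \<open>UPE X\<close> is a countable intersection of sets \<open>{T. h_top X T {P, Q} > 0}\<close>, each of which is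
  Borel because \<open>T \<mapsto> h_top X T {P, Q}\<close> is a Borel function.

  Borel measurability of the entropy: fix a finite open cover \<open>\<U>\<close>. If finitely many cells
  \<open>W\<^sub>1 \<inter> \<dots> \<inter> W\<^sub>n\<close>, with \<open>W\<^sub>i\<close> the preimage of a member of \<open>\<U>\<close> under \<open>T\<^sup>i\<close>, cover \<open>X\<close>, then by
  compactness of \<open>X\<close> the corresponding cells still cover \<open>X\<close> for every map close to \<open>T\<close>. Hence the
  minimal size of a subcover of the \<open>n\<close>-th join is upper semicontinuous in \<open>T\<close>
  (\<open>openin_min_subcover_card_le\<close>), and the entropy is a pointwise limit of Borel functions.

  Reduction to countably many covers: a compact metrizable space has a countable family \<open>\<F>\<close> of
  closed sets with nonempty interior such that every nonempty open set contains a member of \<open>\<F>\<close>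
  (\<open>countable_closed_pi_base\<close>). If \<open>{U, V}\<close> is an open cover by non-dense sets, choose \<open>F, F' \<in> \<F>\<close>
  inside the complements of the closures of \<open>U\<close> and \<open>V\<close>. These complements are disjoint, so
  \<open>{X - F, X - F'}\<close> is again an open cover by non-dense sets, and it is coarser than \<open>{U, V}\<close>.
  Entropy decreases when the cover is coarsened (\<open>h_top_antimono\<close>), so positivity for
  \<open>{X - F, X - F'}\<close> implies positivity for \<open>{U, V}\<close>. Comparing the limits that define the two
  entropies requires that they exist; this is Fekete's lemma, applied to the subadditive
  sequence of logarithms of minimal subcover sizes.
\<close>

section \<open>Subadditive sequences\<close>

lemma subadditive_mult_le:
  fixes a :: "nat \<Rightarrow> real"
  assumes "\<And>m n. a (m + n) \<le> a m + a n"
  shows "a (q * k + r) \<le> real q * a k + a r"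
proof (induction q)
  case (Suc q)
  have "a (Suc q * k + r) \<le> a k + a (q * k + r)"
    using assms[of k "q * k + r"] by (simp add: add.assoc)
  with Suc show ?case
    by (simp add: algebra_simps)
qed simp

text \<open>Fekete's lemma for nonnegative sequences. The limit is the infimum of the quotients: division
  with remainder by an index \<open>k\<close> with nearly minimal \<open>a k / k\<close> bounds \<open>a n / n\<close> by \<open>a k / k\<close> up to
  an error of order \<open>1 / n\<close>.\<close>

lemma convergent_subadditive:
  fixes a :: "nat \<Rightarrow> real"
  assumes sub: "\<And>m n. a (m + n) \<le> a m + a n" and nonneg: "\<And>n. 0 \<le> a n"
  shows "convergent (\<lambda>n. a n / real n)"
proof -
  define L where "L = (INF n\<in>{1..}. a n / real n)"
  have bdd: "bdd_below ((\<lambda>n. a n / real n) ` {1..})"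
    using nonneg by (intro bdd_belowI[of _ 0]) auto
  have "(\<lambda>n. a n / real n) \<longlonglongrightarrow> L"
  proof (rule LIMSEQ_I)
    fix e :: real
    assume "e > 0"
    have "\<exists>k\<in>{1..}. a k / real k < L + e / 2"
      using \<open>e > 0\<close> bdd unfolding L_def by (subst cINF_less_iff[symmetric]) auto
    then obtain k where k: "k \<ge> 1" "a k / real k < L + e / 2"
      by auto
    define M where "M = (\<Sum>r<k. a r)"
    have "M \<ge> 0"
      unfolding M_def using nonneg by (simp add: sum_nonneg)
    obtain n0 :: nat where n0: "real n0 > 2 * M / e"
      using reals_Archimedean2 by blast
    have "norm (a n / real n - L) < e" if n: "n \<ge> Suc n0" for n
    proof -
      have "n > 0"
        using n by simp
      have lower: "L \<le> a n / real n"
        unfolding L_def using bdd \<open>n > 0\<close> by (intro cINF_lower) auto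
      have "a (n mod k) \<le> M"
        unfolding M_def using k nonneg by (intro member_le_sum) auto
      moreover have "a n \<le> real (n div k) * a k + a (n mod k)"
        using subadditive_mult_le[of a, OF sub, of "n div k" k "n mod k"] by simp
      moreover have "real (n div k) * a k \<le> real n * (a k / real k)"
        using mult_right_mono[OF real_of_nat_div[of n k, THEN eq_refl] nonneg[of k]]
          mult_right_mono[OF of_nat_div_le_of_nat[of n k, where 'a = real] nonneg[of k]]
        by simp
      ultimately have "a n \<le> real n * (a k / real k) + M"
        by linarith
      then have "a n / real n \<le> a k / real k + M / real n"
        using \<open>n > 0\<close> by (simp add: field_simps)
      moreover have "M / real n < e / 2"
      proof -
        have "2 * M / e < real n"
          using n n0 by linarith
        then show ?thesis
          using \<open>e > 0\<close> \<open>n > 0\<close> by (simp add: field_simps)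
      qed
      ultimately show ?thesis
        using lower k(2) unfolding real_norm_def by linarith
    qed
    then show "\<exists>no. \<forall>n\<ge>no. norm (a n / real n - L) < e"
      by blast
  qed
  then show ?thesis
    by (rule convergentI)
qed

section \<open>Minimal subcovers\<close>

text \<open>Subcovers are counted through an indexing \<open>f\<close>, so that images under refinement maps or under
  passage from words to cells need not be injective.\<close>

lemma min_subcover_card_le:
  assumes "finite I" "f ` I \<subseteq> \<U>" "\<Union>(f ` I) = topspace X"
  shows "min_subcover_card X \<U> \<le> card I"
proof -
  have "min_subcover_card X \<U> \<le> card (f ` I)"
    unfolding min_subcover_card_def using assms by (intro Least_le exI[of _ "f ` I"]) simp
  also have "\<dots> \<le> card I"
    using assms(1) by (rule card_image_le)
  finally show ?thesis .
qed

lemma min_subcover_card_attained: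
  assumes "finite \<U>" "\<Union>\<U> = topspace X"
  obtains \<V> where "\<V> \<subseteq> \<U>" "finite \<V>" "\<Union>\<V> = topspace X" "card \<V> = min_subcover_card X \<U>"
proof -
  have "\<exists>\<V>. \<V> \<subseteq> \<U> \<and> finite \<V> \<and> \<Union>\<V> = topspace X \<and> card \<V> = min_subcover_card X \<U>"
    unfolding min_subcover_card_def
  proof (rule LeastI[where P = "\<lambda>k. \<exists>\<V>. \<V> \<subseteq> \<U> \<and> finite \<V> \<and> \<Union>\<V> = topspace X \<and> card \<V> = k"])
    show "\<exists>\<V>. \<V> \<subseteq> \<U> \<and> finite \<V> \<and> \<Union>\<V> = topspace X \<and> card \<V> = card \<U>"
      using assms by (intro exI[of _ \<U>]) simp
  qed
  then show ?thesis
    using that by blast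
qed

lemma min_subcover_card_pos:
  assumes "finite \<U>" "\<Union>\<U> = topspace X" "topspace X \<noteq> {}"
  shows "0 < min_subcover_card X \<U>"
proof -
  obtain \<V> where "finite \<V>" "\<Union>\<V> = topspace X" "card \<V> = min_subcover_card X \<U>"
    using min_subcover_card_attained[OF assms(1,2)] .
  then show ?thesis
    using assms(3) by (metis Union_empty card_gt_0_iff)
qed

text \<open>Enlarging each member of an optimal subcover of \<open>\<U>\<close> to a member of \<open>\<W>\<close> gives a subcover of
  \<open>\<W>\<close> that is no larger.\<close>

lemma min_subcover_card_antimono:
  assumes "finite \<U>" "\<Union>\<U> = topspace X" "\<Union>\<W> = topspace X"
    and refines: "\<forall>U\<in>\<U>. \<exists>W\<in>\<W>. U \<subseteq> W"
  shows "min_subcover_card X \<W> \<le> min_subcover_card X \<U>"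
proof -
  obtain \<V> where \<V>: "\<V> \<subseteq> \<U>" "finite \<V>" "\<Union>\<V> = topspace X" "card \<V> = min_subcover_card X \<U>"
    using min_subcover_card_attained[OF assms(1,2)] .
  obtain g where g: "\<forall>U\<in>\<U>. g U \<in> \<W> \<and> U \<subseteq> g U"
    using bchoice[OF refines[unfolded Bex_def]] by (elim exE)
  have sub: "g ` \<V> \<subseteq> \<W>"
    using g \<V>(1) by auto
  have "\<Union>\<V> \<subseteq> \<Union>(g ` \<V>)"
    using g \<V>(1) by (intro Union_least) auto
  then have "\<Union>(g ` \<V>) = topspace X"
    using Union_mono[OF sub] \<V>(3) assms(3) by simp
  then show ?thesis
    using min_subcover_card_le[OF \<V>(2) sub] \<V>(4) by simp
qed

text \<open>The pairwise intersections of two optimal subcovers form a subcover of the join.\<close>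

lemma min_subcover_card_join_le:
  assumes "finite \<U>" "\<Union>\<U> = topspace X" "finite \<V>" "\<Union>\<V> = topspace X"
  shows "min_subcover_card X (cover_join \<U> \<V>) \<le> min_subcover_card X \<U> * min_subcover_card X \<V>"
proof -
  obtain \<U>' where U: "\<U>' \<subseteq> \<U>" "finite \<U>'" "\<Union>\<U>' = topspace X" "card \<U>' = min_subcover_card X \<U>"
    using min_subcover_card_attained[OF assms(1,2)] .
  obtain \<V>' where V: "\<V>' \<subseteq> \<V>" "finite \<V>'" "\<Union>\<V>' = topspace X" "card \<V>' = min_subcover_card X \<V>"
    using min_subcover_card_attained[OF assms(3,4)] .
  have "min_subcover_card X (cover_join \<U> \<V>) \<le> card (\<U>' \<times> \<V>')"
  proof (rule min_subcover_card_le)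
    show "finite (\<U>' \<times> \<V>')"
      using U(2) V(2) by simp
    show "(\<lambda>(A, B). A \<inter> B) ` (\<U>' \<times> \<V>') \<subseteq> cover_join \<U> \<V>"
      using U(1) V(1) by (auto simp: cover_join_def)
    have "\<Union>((\<lambda>(A, B). A \<inter> B) ` (\<U>' \<times> \<V>')) = \<Union>\<U>' \<inter> \<Union>\<V>'"
      by auto
    then show "\<Union>((\<lambda>(A, B). A \<inter> B) ` (\<U>' \<times> \<V>')) = topspace X"
      using U(3) V(3) by simp
  qed
  then show ?thesis
    using U(4) V(4) by (simp add: card_cartesian_product)
qed

lemma funpow_in_topspace:
  assumes "T \<in> topspace X \<rightarrow> topspace X" "x \<in> topspace X"
  shows "(T ^^ n) x \<in> topspace X"
  using assms by (induction n) auto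

lemma Union_cover_preimage:
  assumes "T \<in> topspace X \<rightarrow> topspace X" "\<Union>\<U> = topspace X"
  shows "\<Union>(cover_preimage X T m \<U>) = topspace X"
proof -
  have "\<Union>(cover_preimage X T m \<U>) = {x \<in> topspace X. (T ^^ m) x \<in> \<Union>\<U>}"
    unfolding cover_preimage_def by auto
  then show ?thesis
    using funpow_in_topspace[OF assms(1)] assms(2) by auto
qed

lemma min_subcover_card_preimage_le:
  assumes "T \<in> topspace X \<rightarrow> topspace X" "finite \<U>" "\<Union>\<U> = topspace X"
  shows "min_subcover_card X (cover_preimage X T m \<U>) \<le> min_subcover_card X \<U>"
proof -
  obtain \<V> where \<V>: "\<V> \<subseteq> \<U>" "finite \<V>" "\<Union>\<V> = topspace X" "card \<V> = min_subcover_card X \<U>"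
    using min_subcover_card_attained[OF assms(2,3)] .
  have "min_subcover_card X (cover_preimage X T m \<U>) \<le> card \<V>"
    using \<V>(1,2) Union_cover_preimage[OF assms(1) \<V>(3), of m] unfolding cover_preimage_def
    by (intro min_subcover_card_le[of _ "\<lambda>U. {x \<in> topspace X. (T ^^ m) x \<in> U}"] image_mono)
  then show ?thesis
    using \<V>(4) by simp
qed

section \<open>Entropy of a finite cover\<close>

lemma finite_cover_join: "finite \<U> \<Longrightarrow> finite \<V> \<Longrightarrow> finite (cover_join \<U> \<V>)"
  unfolding cover_join_def by (rule finite_image_set2) simp_all

lemma Union_cover_join: "\<Union>(cover_join \<U> \<V>) = \<Union>\<U> \<inter> \<Union>\<V>"
  unfolding cover_join_def by blast

lemma finite_cover_iterate: "finite \<U> \<Longrightarrow> finite (cover_iterate X T \<U> n)"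
  by (induction n) (simp_all add: finite_cover_join cover_preimage_def)

lemma Union_cover_iterate:
  assumes "T \<in> topspace X \<rightarrow> topspace X" "\<Union>\<U> = topspace X"
  shows "\<Union>(cover_iterate X T \<U> n) = topspace X"
  by (induction n) (simp_all add: Union_cover_join Union_cover_preimage assms)

lemma bex_cover_join: "(\<exists>A\<in>cover_join \<U> \<V>. P A) \<longleftrightarrow> (\<exists>U\<in>\<U>. \<exists>V\<in>\<V>. P (U \<inter> V))"
  by (auto simp: cover_join_def)

lemma cover_join_iff: "A \<in> cover_join \<U> \<V> \<longleftrightarrow> (\<exists>U\<in>\<U>. \<exists>V\<in>\<V>. A = U \<inter> V)"
  by (auto simp: cover_join_def)

lemma cover_join_assoc: "cover_join (cover_join \<U> \<V>) \<W> = cover_join \<U> (cover_join \<V> \<W>)"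
  by (rule set_eqI) (simp add: cover_join_iff bex_cover_join Int_assoc)

lemma cover_preimage_join:
  "cover_preimage X T m (cover_join \<U> \<V>)
     = cover_join (cover_preimage X T m \<U>) (cover_preimage X T m \<V>)"
proof -
  define P where "P = (\<lambda>U. {x \<in> topspace X. (T ^^ m) x \<in> U})"
  have "P (U \<inter> V) = P U \<inter> P V" for U V
    unfolding P_def by auto
  then have "P ` cover_join \<U> \<V> = cover_join (P ` \<U>) (P ` \<V>)"
    by (intro set_eqI) (simp add: image_iff cover_join_iff bex_cover_join)
  then show ?thesis
    unfolding cover_preimage_def P_def .
qed

lemma cover_preimage_preimage:
  assumes "T \<in> topspace X \<rightarrow> topspace X"
  shows "cover_preimage X T m (cover_preimage X T k \<U>) = cover_preimage X T (m + k) \<U>"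
proof -
  have "{x \<in> topspace X. (T ^^ m) x \<in> {y \<in> topspace X. (T ^^ k) y \<in> U}}
      = {x \<in> topspace X. (T ^^ (m + k)) x \<in> U}" for U
    using funpow_in_topspace[OF assms, of _ m] by (auto simp: funpow_add add.commute[of m k])
  then show ?thesis
    unfolding cover_preimage_def by (simp add: image_image)
qed

text \<open>The join over the times \<open>1, \<dots>, m + n\<close> splits at time \<open>m\<close>; this is the source of
  subadditivity.\<close>

lemma cover_iterate_add:
  assumes T: "T \<in> topspace X \<rightarrow> topspace X" and cover: "\<Union>\<U> = topspace X"
  shows "cover_iterate X T \<U> (m + n)
    = cover_join (cover_iterate X T \<U> m) (cover_preimage X T m (cover_iterate X T \<U> n))"
proof (induction n)
  case 0
  have "cover_preimage X T m {topspace X} = {topspace X}"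
    using funpow_in_topspace[OF T, of _ m] unfolding cover_preimage_def by auto
  moreover have "cover_join (cover_iterate X T \<U> m) {topspace X} = cover_iterate X T \<U> m"
  proof -
    have "A \<inter> topspace X = A" if "A \<in> cover_iterate X T \<U> m" for A
      using that Union_cover_iterate[OF T cover, of m] by blast
    then show ?thesis
      unfolding cover_join_def by force
  qed
  ultimately show ?case
    by simp
next
  case (Suc n)
  then show ?case
    by (simp add: cover_preimage_join cover_join_assoc cover_preimage_preimage[OF T])
qed

lemma cover_iterate_refines:
  assumes "\<forall>U\<in>\<U>. \<exists>W\<in>\<W>. U \<subseteq> W"
  shows "\<forall>A\<in>cover_iterate X T \<U> n. \<exists>B\<in>cover_iterate X T \<W> n. A \<subseteq> B"
proof (induction n)
  case (Suc n)
  show ?case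
  proof
    fix A
    assume "A \<in> cover_iterate X T \<U> (Suc n)"
    then obtain A' U where A: "A' \<in> cover_iterate X T \<U> n" "U \<in> \<U>"
        "A = A' \<inter> {x \<in> topspace X. (T ^^ Suc n) x \<in> U}"
      by (auto simp: cover_join_def cover_preimage_def)
    obtain B' W where "B' \<in> cover_iterate X T \<W> n" "A' \<subseteq> B'" "W \<in> \<W>" "U \<subseteq> W"
      using Suc A(1,2) assms by blast
    then show "\<exists>B\<in>cover_iterate X T \<W> (Suc n). A \<subseteq> B"
      unfolding A(3)
      by (intro bexI[of _ "B' \<inter> {x \<in> topspace X. (T ^^ Suc n) x \<in> W}"])
         (auto simp: cover_join_def cover_preimage_def)
  qed
qed simp

text \<open>By the splitting \<open>cover_iterate_add\<close> the minimal subcover sizes are submultiplicative, so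
  their logarithms are subadditive and Fekete's lemma provides the limit.\<close>

lemma h_top_LIMSEQ:
  assumes ne: "topspace X \<noteq> {}" and T: "T \<in> topspace X \<rightarrow> topspace X"
    and cover: "finite \<U>" "\<Union>\<U> = topspace X"
  shows "(\<lambda>n. ln (real (min_subcover_card X (cover_iterate X T \<U> n))) / real n)
           \<longlonglongrightarrow> h_top X T \<U>"
proof -
  let ?N = "\<lambda>n. min_subcover_card X (cover_iterate X T \<U> n)"
  have pos: "0 < ?N n" for n
    by (intro min_subcover_card_pos finite_cover_iterate Union_cover_iterate assms)
  have sub: "?N (m + n) \<le> ?N m * ?N n" for m n
  proof -
    have "finite (cover_preimage X T m (cover_iterate X T \<U> n))"
      using finite_cover_iterate[OF cover(1)] by (simp add: cover_preimage_def)
    then have "?N (m + n)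
        \<le> ?N m * min_subcover_card X (cover_preimage X T m (cover_iterate X T \<U> n))"
      unfolding cover_iterate_add[OF T cover(2)]
      by (intro min_subcover_card_join_le Union_cover_preimage finite_cover_iterate
          Union_cover_iterate T cover)
    also have "\<dots> \<le> ?N m * ?N n"
      by (intro mult_left_mono min_subcover_card_preimage_le finite_cover_iterate
          Union_cover_iterate T cover) simp
    finally show ?thesis .
  qed
  have "ln (real (?N (m + n))) \<le> ln (real (?N m * ?N n))" for m n
    using sub[of m n] pos[of "m + n"] pos[of m] pos[of n]
    by (subst ln_le_cancel_iff) (simp_all del: of_nat_mult)
  moreover have "ln (real (?N m * ?N n)) = ln (real (?N m)) + ln (real (?N n))" for m n
    using pos[of m] pos[of n] by (simp add: ln_mult)
  ultimately have "ln (real (?N (m + n))) \<le> ln (real (?N m)) + ln (real (?N n))" for m n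
    by simp
  moreover have "0 \<le> ln (real (?N n))" for n
    using pos[of n] by (intro ln_ge_zero) linarith
  ultimately have "convergent (\<lambda>n. ln (real (?N n)) / real n)"
    by (rule convergent_subadditive)
  then show ?thesis
    unfolding h_top_def by (simp add: convergent_LIMSEQ_iff)
qed

text \<open>Refinement passes to the iterated joins, hence the terms of the two defining sequences compare,
  and so do their limits because both exist.\<close>

lemma h_top_antimono:
  assumes "topspace X \<noteq> {}" "T \<in> topspace X \<rightarrow> topspace X"
    and "finite \<U>" "\<Union>\<U> = topspace X" "finite \<W>" "\<Union>\<W> = topspace X"
    and refines: "\<forall>U\<in>\<U>. \<exists>W\<in>\<W>. U \<subseteq> W"
  shows "h_top X T \<W> \<le> h_top X T \<U>"
proof (rule LIMSEQ_le[OF h_top_LIMSEQ h_top_LIMSEQ])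
  have "ln (real (min_subcover_card X (cover_iterate X T \<W> n)))
      \<le> ln (real (min_subcover_card X (cover_iterate X T \<U> n)))" for n
  proof -
    have "0 < min_subcover_card X (cover_iterate X T \<W> n)"
      by (intro min_subcover_card_pos finite_cover_iterate Union_cover_iterate assms)
    moreover have "min_subcover_card X (cover_iterate X T \<W> n)
        \<le> min_subcover_card X (cover_iterate X T \<U> n)"
      by (intro min_subcover_card_antimono cover_iterate_refines finite_cover_iterate
          Union_cover_iterate assms)
    ultimately show ?thesis
      by simp
  qed
  then show "\<exists>N. \<forall>n\<ge>N. ln (real (min_subcover_card X (cover_iterate X T \<W> n))) / real n
      \<le> ln (real (min_subcover_card X (cover_iterate X T \<U> n))) / real n"
    by (intro exI allI impI divide_right_mono) simp_all
qed (use assms in auto)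

section \<open>Semicontinuity and measurability in the map\<close>

text \<open>The tube lemma, in the form that universal quantification over a compact factor preserves
  openness: the complement is the image of a closed set under the closed map \<open>fst\<close>.\<close>

lemma openin_forall_compact:
  assumes "compact_space Y" "openin (prod_topology Z Y) E"
  shows "openin Z {z \<in> topspace Z. \<forall>y\<in>topspace Y. (z, y) \<in> E}"
proof -
  have "closedin (prod_topology Z Y) (topspace (prod_topology Z Y) - E)"
    using assms(2) by blast
  then have "closedin Z (fst ` (topspace (prod_topology Z Y) - E))"
    using closed_map_fst[OF assms(1), of Z] by (simp add: closed_map_def)
  then have "openin Z (topspace Z - fst ` (topspace (prod_topology Z Y) - E))"
    by blast
  also have "topspace Z - fst ` (topspace (prod_topology Z Y) - E)
      = {z \<in> topspace Z. \<forall>y\<in>topspace Y. (z, y) \<in> E}"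
    by force
  finally show ?thesis .
qed

text \<open>Joint continuity: if \<open>T\<close> is uniformly close to \<open>S\<close> and \<open>S y\<close> is close to \<open>S x\<close>, then \<open>T y\<close> is
  close to \<open>S x\<close> by the triangle inequality.\<close>

lemma continuous_map_TDS_eval:
  assumes X: "compact_space X" and m: "mtopology_of m = X"
  shows "continuous_map (prod_topology (TDS_topology X m) X) X (\<lambda>(T, x). T x)"
proof -
  interpret Metric_space "mspace m" "mdist m"
    by (rule Metric_space_mspace_mdist)
  interpret C: Metric_space "mspace (cfunspace X m)" "mdist (cfunspace X m)"
    by (rule Metric_space_mspace_mdist)
  note mspace_cfunspace [simp del]
  have X_eq: "X = mtopology"
    using m by (simp add: mtopology_of_def)
  have top_X: "topspace X = mspace m"
    using X_eq by simp
  have TDS_eq: "TDS_topology X m = C.mtopology"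
    by (simp add: TDS_topology_def mtopology_of_def)
  have top: "topspace (TDS_topology X m) = TDS X"
    using X m by (rule topspace_TDS_topology)
  have space: "mspace (cfunspace X m) = TDS X"
    using top by (simp only: TDS_eq C.topspace_mtopology)
  have maps: "T x \<in> topspace X" if "T \<in> TDS X" "x \<in> topspace X" for T x
    using that by (auto simp: TDS_def continuous_map_def)
  let ?Z = "prod_topology (TDS_topology X m) X"
  have "openin ?Z {p \<in> topspace ?Z. (\<lambda>(T, x). T x) p \<in> W}" if W: "openin X W" for W
    unfolding openin_prod_topology_alt
  proof (intro allI impI)
    fix S x
    assume "(S, x) \<in> {p \<in> topspace ?Z. (\<lambda>(T, x). T x) p \<in> W}"
    then have S: "S \<in> TDS X" and x: "x \<in> topspace X" and "S x \<in> W"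
      by (auto simp: top)
    then obtain e where e: "e > 0" "mball (S x) e \<subseteq> W"
      using W unfolding X_eq openin_mtopology by blast
    define A where "A = C.mball S (e / 2)"
    define B where "B = {y \<in> topspace X. S y \<in> mball (S x) (e / 2)}"
    have A_iff: "T \<in> A \<longleftrightarrow> T \<in> TDS X \<and> mdist (cfunspace X m) S T < e / 2" for T
      unfolding A_def C.in_mball using S by (simp add: space)
    have "openin X B"
      unfolding B_def using S
      by (intro openin_continuous_map_preimage[where Y = X])
         (auto simp: TDS_def X_eq)
    moreover have "openin (TDS_topology X m) A"
      unfolding A_def TDS_eq by (rule C.openin_mball)
    moreover have "S \<in> A"
      unfolding A_iff using S C.mdist_zero[of S] e(1) by (simp add: space)
    moreover have "x \<in> B"
      using x maps[OF S x] e(1) unfolding B_def by (simp add: top_X)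
    moreover have "A \<times> B \<subseteq> {p \<in> topspace ?Z. (\<lambda>(T, x). T x) p \<in> W}"
    proof (rule subrelI)
      fix T y
      assume "(T, y) \<in> A \<times> B"
      then have T: "T \<in> TDS X" and ST: "mdist (cfunspace X m) S T < e / 2"
        and y: "y \<in> topspace X" and Sy: "mdist m (S x) (S y) < e / 2"
        using A_iff[of T] unfolding B_def by auto
      have in_m: "S x \<in> mspace m" "S y \<in> mspace m" "T y \<in> mspace m"
        using maps S T x y top_X by auto
      have "mdist m (S y) (T y) \<le> mdist (cfunspace X m) S T"
        by (rule mdist_cfunspace_imp_mdist_le[where X = X]) (use S T y in \<open>simp_all add: space\<close>)
      then have "mdist m (S x) (T y) < e"
        using triangle[OF in_m] ST Sy by linarith
      then have "T y \<in> W"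
        using e(2) in_m by auto
      then show "(T, y) \<in> {p \<in> topspace ?Z. (\<lambda>(T, x). T x) p \<in> W}"
        using T y top by simp
    qed
    ultimately show "\<exists>U V. openin (TDS_topology X m) U \<and> openin X V \<and> S \<in> U \<and> x \<in> V
        \<and> U \<times> V \<subseteq> {p \<in> topspace ?Z. (\<lambda>(T, x). T x) p \<in> W}"
      by (intro exI[of _ A] exI[of _ B] conjI)
  qed
  then show ?thesis
    using maps by (auto simp: continuous_map_def top)
qed

lemma continuous_map_TDS_funpow_eval:
  assumes "compact_space X" "mtopology_of m = X"
  shows "continuous_map (prod_topology (TDS_topology X m) X) X (\<lambda>(T, x). (T ^^ n) x)"
proof (induction n)
  case 0
  then show ?case
    using continuous_map_snd[of "TDS_topology X m" X] by (simp add: case_prod_unfold)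
next
  case (Suc n)
  have "continuous_map (prod_topology (TDS_topology X m) X) (prod_topology (TDS_topology X m) X)
      (\<lambda>p. (fst p, (fst p ^^ n) (snd p)))"
    using Suc by (intro continuous_map_pairedI continuous_map_fst) (simp add: case_prod_unfold)
  from continuous_map_compose[OF this continuous_map_TDS_eval[OF assms]]
  show ?case
    by (simp add: case_prod_unfold o_def)
qed

text \<open>The members of the iterated cover are indexed by words \<open>w\<close> over the cover. The words, unlike
  the sets, do not depend on the map, so a subcover can be followed when the map varies.\<close>

lemma cover_iterate_iff:
  "A \<in> cover_iterate X T \<U> n \<longleftrightarrow>
     (\<exists>w. (\<forall>i\<in>{1..n}. w i \<in> \<U>) \<and> A = {x \<in> topspace X. \<forall>i\<in>{1..n}. (T ^^ i) x \<in> w i})"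
proof (induction n arbitrary: A)
  case (Suc n)
  let ?cell = "\<lambda>n w. {x \<in> topspace X. \<forall>i\<in>{1..n}. (T ^^ i) x \<in> w i}"
  have interval: "{1..Suc n} = insert (Suc n) {1..n}"
    by auto
  show ?case
  proof
    assume "A \<in> cover_iterate X T \<U> (Suc n)"
    then obtain B U where "B \<in> cover_iterate X T \<U> n" "U \<in> \<U>"
        "A = B \<inter> {x \<in> topspace X. (T ^^ Suc n) x \<in> U}"
      by (auto simp: cover_join_def cover_preimage_def)
    moreover from this(1) obtain w where "\<forall>i\<in>{1..n}. w i \<in> \<U>" "B = ?cell n w"
      using Suc by blast
    ultimately show "\<exists>w. (\<forall>i\<in>{1..Suc n}. w i \<in> \<U>) \<and> A = ?cell (Suc n) w"
      unfolding interval by (intro exI[of _ "w(Suc n := U)"]) auto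
  next
    assume "\<exists>w. (\<forall>i\<in>{1..Suc n}. w i \<in> \<U>) \<and> A = ?cell (Suc n) w"
    then obtain w where w: "\<forall>i\<in>{1..Suc n}. w i \<in> \<U>" "A = ?cell (Suc n) w"
      by blast
    then have "A = ?cell n w \<inter> {x \<in> topspace X. (T ^^ Suc n) x \<in> w (Suc n)}"
      unfolding interval by auto
    moreover have "?cell n w \<in> cover_iterate X T \<U> n"
      unfolding Suc using w(1) by (intro exI[of _ w]) auto
    moreover have "w (Suc n) \<in> \<U>"
      using w(1) by auto
    ultimately show "A \<in> cover_iterate X T \<U> (Suc n)"
      by (auto simp: cover_join_def cover_preimage_def)
  qed
qed auto

text \<open>The condition on a pair \<open>(T, x)\<close> is open by joint continuity of the iterates, and quantifying
  over the compact space of points \<open>x\<close> keeps it open in \<open>T\<close>.\<close>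

lemma openin_TDS_words_cover:
  assumes "compact_space X" "mtopology_of m = X"
    and w: "\<And>s i. s \<in> I \<Longrightarrow> i \<in> {1..n} \<Longrightarrow> openin X (w s i)"
  shows "openin (TDS_topology X m)
    {T \<in> TDS X. \<forall>x\<in>topspace X. \<exists>s\<in>I. \<forall>i\<in>{1..n}. (T ^^ i) x \<in> w s i}"
proof -
  let ?Z = "prod_topology (TDS_topology X m) X"
  define E where "E s = topspace ?Z \<inter> (\<Inter>i\<in>{1..n}. {p \<in> topspace ?Z. (fst p ^^ i) (snd p) \<in> w s i})" for s
  have "openin ?Z (E s)" if "s \<in> I" for s
    unfolding E_def
  proof (intro openin_Int_Inter)
    fix K
    assume "K \<in> (\<lambda>i. {p \<in> topspace ?Z. (fst p ^^ i) (snd p) \<in> w s i}) ` {1..n}"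
    then obtain i where i: "i \<in> {1..n}" "K = {p \<in> topspace ?Z. (fst p ^^ i) (snd p) \<in> w s i}"
      by blast
    show "openin ?Z K"
      unfolding i(2) using continuous_map_TDS_funpow_eval[OF assms(1,2), of i] w[OF \<open>s \<in> I\<close> i(1)]
      unfolding case_prod_unfold by (rule openin_continuous_map_preimage)
  next
    show "openin ?Z (topspace ?Z)"
      by (rule openin_topspace)
  qed simp
  then have "openin ?Z (\<Union>s\<in>I. E s)"
    by blast
  from openin_forall_compact[OF assms(1) this]
  have "openin (TDS_topology X m)
      {T \<in> topspace (TDS_topology X m). \<forall>x\<in>topspace X. (T, x) \<in> (\<Union>s\<in>I. E s)}" .
  also have "\<dots> = {T \<in> TDS X. \<forall>x\<in>topspace X. \<exists>s\<in>I. \<forall>i\<in>{1..n}. (T ^^ i) x \<in> w s i}"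
  proof -
    have "(T, x) \<in> E s \<longleftrightarrow> (\<forall>i\<in>{1..n}. (T ^^ i) x \<in> w s i)"
      if "T \<in> TDS X" "x \<in> topspace X" for T x s
      using that by (auto simp: E_def topspace_TDS_topology[OF assms(1,2)])
    then show ?thesis
      unfolding topspace_TDS_topology[OF assms(1,2)]
      by (intro Collect_cong conj_cong refl ball_cong) simp
  qed
  finally show ?thesis .
qed

text \<open>Upper semicontinuity of the minimal subcover size: the words of an optimal subcover for \<open>T\<close>
  still give a cover for all maps near \<open>T\<close>.\<close>

lemma openin_min_subcover_card_le:
  assumes X: "compact_space X" and m: "mtopology_of m = X"
    and cover: "finite \<U>" "open_cover X \<U>"
  shows "openin (TDS_topology X m)
    {T \<in> TDS X. min_subcover_card X (cover_iterate X T \<U> n) \<le> k}"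
proof (subst openin_subopen, intro ballI)
  fix T
  assume "T \<in> {T \<in> TDS X. min_subcover_card X (cover_iterate X T \<U> n) \<le> k}"
  then have T: "T \<in> TDS X" and le: "min_subcover_card X (cover_iterate X T \<U> n) \<le> k"
    by auto
  have Un: "\<Union>\<U> = topspace X"
    using cover(2) by (simp add: open_cover_def)
  have maps: "T \<in> topspace X \<rightarrow> topspace X"
    using T by (auto simp: TDS_def continuous_map_def)
  obtain \<V> where \<V>: "\<V> \<subseteq> cover_iterate X T \<U> n" "finite \<V>" "\<Union>\<V> = topspace X"
      "card \<V> = min_subcover_card X (cover_iterate X T \<U> n)"
    using min_subcover_card_attained[OF finite_cover_iterate Union_cover_iterate, OF cover(1) maps Un] .
  have "\<forall>A\<in>\<V>. \<exists>w. (\<forall>i\<in>{1..n}. w i \<in> \<U>)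
      \<and> A = {x \<in> topspace X. \<forall>i\<in>{1..n}. (T ^^ i) x \<in> w i}"
    using \<V>(1) cover_iterate_iff[of _ X T \<U> n] by blast
  from bchoice[OF this] obtain w where w: "\<forall>A\<in>\<V>. (\<forall>i\<in>{1..n}. w A i \<in> \<U>)
      \<and> A = {x \<in> topspace X. \<forall>i\<in>{1..n}. (T ^^ i) x \<in> w A i}"
    by (elim exE)
  note w_cover = bspec[OF w, THEN conjunct1, THEN bspec]
  define O' where
    "O' = {S \<in> TDS X. \<forall>x\<in>topspace X. \<exists>A\<in>\<V>. \<forall>i\<in>{1..n}. (S ^^ i) x \<in> w A i}"
  have "openin (TDS_topology X m) O'"
    unfolding O'_def
  proof (rule openin_TDS_words_cover[OF X m])
    show "openin X (w A i)" if "A \<in> \<V>" "i \<in> {1..n}" for A i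
      using w_cover[OF that] cover(2) by (simp add: open_cover_def)
  qed
  moreover have "T \<in> O'"
  proof -
    have "\<exists>A\<in>\<V>. \<forall>i\<in>{1..n}. (T ^^ i) x \<in> w A i" if x: "x \<in> topspace X" for x
    proof -
      obtain A where A: "A \<in> \<V>" "x \<in> A"
        using x unfolding \<V>(3)[symmetric] by (elim UnionE)
      then have "x \<in> {x \<in> topspace X. \<forall>i\<in>{1..n}. (T ^^ i) x \<in> w A i}"
        using bspec[OF w A(1)] by (elim conjE) (rule subst)
      then show ?thesis
        using A(1) by auto
    qed
    then show ?thesis
      using T by (simp add: O'_def)
  qed
  moreover have "min_subcover_card X (cover_iterate X S \<U> n) \<le> k" if S: "S \<in> O'" for S
  proof -
    let ?cell = "\<lambda>A. {x \<in> topspace X. \<forall>i\<in>{1..n}. (S ^^ i) x \<in> w A i}"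
    have "?cell ` \<V> \<subseteq> cover_iterate X S \<U> n"
    proof (rule image_subsetI)
      fix A
      assume "A \<in> \<V>"
      then show "?cell A \<in> cover_iterate X S \<U> n"
        unfolding cover_iterate_iff using w_cover by (intro exI[of _ "w A"]) simp
    qed
    moreover have "\<Union>(?cell ` \<V>) = topspace X"
      using S unfolding O'_def by fast
    ultimately have "min_subcover_card X (cover_iterate X S \<U> n) \<le> card \<V>"
      by (rule min_subcover_card_le[OF \<V>(2)])
    then show ?thesis
      using \<V>(4) le by simp
  qed
  ultimately show "\<exists>W. openin (TDS_topology X m) W \<and> T \<in> W
      \<and> W \<subseteq> {T \<in> TDS X. min_subcover_card X (cover_iterate X T \<U> n) \<le> k}"
    by (intro exI[of _ O']) (auto simp: O'_def)
qed

lemma space_borel_of: "space (borel_of Y) = topspace Y"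
  unfolding borel_of_def by (rule space_measure_of) (use openin_subset in blast)

lemma sets_borel_of_openin: "openin Y U \<Longrightarrow> U \<in> sets (borel_of Y)"
  unfolding borel_of_def by (subst sets_measure_of) (use openin_subset in blast)+

lemma borel_measurable_h_top:
  assumes X: "compact_space X" and m: "mtopology_of m = X"
    and cover: "finite \<U>" "open_cover X \<U>"
  shows "(\<lambda>T. h_top X T \<U>) \<in> borel_measurable (borel_of (TDS_topology X m))"
proof -
  let ?M = "borel_of (TDS_topology X m)"
  have [measurable]:
    "(\<lambda>T. real (min_subcover_card X (cover_iterate X T \<U> n))) \<in> borel_measurable ?M" for n
  proof (rule borel_measurableI_le)
    fix a :: real
    show "{T \<in> space ?M. real (min_subcover_card X (cover_iterate X T \<U> n)) \<le> a} \<in> sets ?M"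
      \<comment> \<open>The sizes are natural numbers, so a nonnegative bound can be rounded down.\<close>
    proof (cases "a < 0")
      case True
      then have "\<not> real k \<le> a" for k
        by (meson less_le_trans not_le of_nat_0_le_iff)
      then show ?thesis
        by simp
    next
      case False
      then have "real k \<le> a \<longleftrightarrow> k \<le> nat \<lfloor>a\<rfloor>" for k
        by (simp add: le_nat_iff le_floor_iff)
      then show ?thesis
        using openin_min_subcover_card_le[OF assms, of n "nat \<lfloor>a\<rfloor>"]
        by (simp add: space_borel_of topspace_TDS_topology[OF X m] sets_borel_of_openin)
    qed
  qed
  show ?thesis
    unfolding h_top_def by measurable
qed

section \<open>Countably many covers suffice\<close>

text \<open>Total boundedness provides for each \<open>n\<close> finitely many balls of radius \<open>1 / (n + 1)\<close> covering the
  space; the corresponding closed balls form the family.\<close>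

lemma countable_closed_pi_base:
  assumes "compact_space X" "metrizable_space X"
  obtains \<F> where "countable \<F>" "\<And>F. F \<in> \<F> \<Longrightarrow> closedin X F" "\<And>F. F \<in> \<F> \<Longrightarrow> X interior_of F \<noteq> {}"
    "\<And>A. openin X A \<Longrightarrow> A \<noteq> {} \<Longrightarrow> \<exists>F\<in>\<F>. F \<subseteq> A"
proof -
  obtain M d where "Metric_space M d" and X: "X = Metric_space.mtopology M d"
    using assms(2) unfolding metrizable_space_def by blast
  interpret Metric_space M d
    by fact
  have "mtotally_bounded M"
    using assms(1) unfolding X compact_space_def by (intro compactin_imp_mtotally_bounded) simp
  then have "\<exists>K. finite K \<and> K \<subseteq> M \<and> M \<subseteq> (\<Union>x\<in>K. mball x (1 / real (Suc n)))" for n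
    unfolding mtotally_bounded_def by simp
  then obtain K where K: "\<And>n. finite (K n)" "\<And>n. K n \<subseteq> M"
      "\<And>n. M \<subseteq> (\<Union>x\<in>K n. mball x (1 / real (Suc n)))"
    by metis
  define \<F> where "\<F> = (\<Union>n. (\<lambda>x. mcball x (1 / real (Suc n))) ` K n)"
  show ?thesis
  proof
    show "countable \<F>"
      unfolding \<F>_def using K(1) by (intro countable_UN countable_image) (auto intro: countable_finite)
    show "closedin X F" if "F \<in> \<F>" for F
      using that unfolding \<F>_def X by auto
    show "X interior_of F \<noteq> {}" if F: "F \<in> \<F>" for F
    proof -
      obtain n x where x: "x \<in> K n" "F = mcball x (1 / real (Suc n))"
        using F unfolding \<F>_def by blast
      have "mball x (1 / real (Suc n)) \<subseteq> X interior_of F"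
        unfolding x(2) X by (intro interior_of_maximal) auto
      moreover have "x \<in> mball x (1 / real (Suc n))"
        using subsetD[OF K(2) x(1)] by simp
      ultimately show ?thesis
        by blast
    qed
    show "\<exists>F\<in>\<F>. F \<subseteq> A" if A: "openin X A" "A \<noteq> {}" for A
    proof -
      obtain a where "a \<in> A"
        using A(2) by blast
      then obtain e where e: "e > 0" "mball a e \<subseteq> A"
        using A(1) unfolding X openin_mtopology by blast
      have a: "a \<in> M"
        using A(1) \<open>a \<in> A\<close> openin_subset unfolding X by fastforce
      \<comment> \<open>A closed ball of radius less than \<open>e / 2\<close> that contains \<open>a\<close> stays within distance \<open>e\<close>.\<close>
      obtain n where n: "1 / real (Suc n) < e / 2"
        using e(1) nat_approx_posE[of "e / 2"] by auto
      obtain x where x: "x \<in> K n" "a \<in> mball x (1 / real (Suc n))"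
        using K(3)[of n] a by blast
      have "mcball x (1 / real (Suc n)) \<subseteq> mball a e"
      proof
        fix y
        assume y: "y \<in> mcball x (1 / real (Suc n))"
        have "d a y \<le> d a x + d x y"
          using triangle a x(2) y by auto
        then show "y \<in> mball a e"
          using x(2) y n a by (auto simp: commute)
      qed
      then show ?thesis
        using x(1) e(2) unfolding \<F>_def by blast
    qed
  qed
qed

text \<open>The nonempty open complements of the closures of \<open>U\<close> and \<open>V\<close> are disjoint because \<open>U\<close> and \<open>V\<close>
  cover the space. Members \<open>F\<close> and \<open>G\<close> of the family inside them give a cover that is coarser
  than \<open>{U, V}\<close>, whose sets are still not dense because \<open>F\<close> and \<open>G\<close> have interior points.\<close>

lemma has_UPE_iff_pi_base:
  assumes "\<And>F. F \<in> \<F> \<Longrightarrow> closedin X F" "\<And>F. F \<in> \<F> \<Longrightarrow> X interior_of F \<noteq> {}"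
    and small: "\<And>A. openin X A \<Longrightarrow> A \<noteq> {} \<Longrightarrow> \<exists>F\<in>\<F>. F \<subseteq> A"
    and T: "T \<in> TDS X"
  shows "has_UPE X T \<longleftrightarrow>
    (\<forall>(F, G)\<in>{(F, G) \<in> \<F> \<times> \<F>. F \<inter> G = {}}. 0 < h_top X T {topspace X - F, topspace X - G})"
    (is "_ \<longleftrightarrow> ?R")
proof
  have cover: "open_cover X {topspace X - F, topspace X - G}" if "F \<in> \<F>" "G \<in> \<F>" "F \<inter> G = {}" for F G
  proof -
    have "topspace X - F \<union> (topspace X - G) = topspace X"
      using that(3) by auto
    then show ?thesis
      using that(1,2) assms(1) by (simp add: open_cover_def openin_diff)
  qed
  show ?R if UPE: "has_UPE X T"
  proof -
    have "X closure_of (topspace X - F) \<noteq> topspace X" if "F \<in> \<F>" for F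
      using assms(2)[OF that] interior_of_subset_topspace[of X F] by (auto simp: closure_of_complement)
    then have "0 < h_top X T {topspace X - F, topspace X - G}"
      if "F \<in> \<F>" "G \<in> \<F>" "F \<inter> G = {}" for F G
      using UPE cover[OF that] that(1,2) unfolding has_UPE_def by simp
    then show ?thesis
      by simp
  qed
  show "has_UPE X T" if R: ?R
    unfolding has_UPE_def
  proof (intro allI impI, elim conjE)
    fix U V
    assume UV: "open_cover X {U, V}" "X closure_of U \<noteq> topspace X" "X closure_of V \<noteq> topspace X"
    have avoid: "\<exists>F\<in>\<F>. F \<subseteq> topspace X - X closure_of W" if "X closure_of W \<noteq> topspace X" for W
      using that closure_of_subset_topspace[of X W]
      by (intro small openin_diff openin_topspace closedin_closure_of) simp
    obtain F where F: "F \<in> \<F>" "F \<subseteq> topspace X - X closure_of U"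
      using avoid[OF UV(2)] by (elim bexE)
    obtain G where G: "G \<in> \<F>" "G \<subseteq> topspace X - X closure_of V"
      using avoid[OF UV(3)] by (elim bexE)
    have sub: "U \<union> V = topspace X"
      using UV(1) by (simp add: open_cover_def)
    then have closure: "U \<subseteq> X closure_of U" "V \<subseteq> X closure_of V"
      by (auto intro!: closure_of_subset)
    have "F \<inter> U = {}" "G \<inter> V = {}"
      using F(2) G(2) closure by auto
    then have "F \<inter> G = {}" "U \<subseteq> topspace X - F" "V \<subseteq> topspace X - G"
      using sub F(2) G(2) by auto
    then have "0 < h_top X T {topspace X - F, topspace X - G}"
      using R F(1) G(1) by simp
    also have "\<dots> \<le> h_top X T {U, V}"
    proof (rule h_top_antimono)
      show "topspace X \<noteq> {}"
        using UV(2) closure_of_subset_topspace[of X U] by auto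
      show "T \<in> topspace X \<rightarrow> topspace X"
        using T by (auto simp: TDS_def continuous_map_def)
      show "\<Union>{topspace X - F, topspace X - G} = topspace X"
        using \<open>F \<inter> G = {}\<close> by auto
      show "\<Union>{U, V} = topspace X"
        using sub by simp
      show "\<forall>U'\<in>{U, V}. \<exists>W\<in>{topspace X - F, topspace X - G}. U' \<subseteq> W"
        using \<open>U \<subseteq> topspace X - F\<close> \<open>V \<subseteq> topspace X - G\<close> by simp
    qed simp_all
    finally show "0 < h_top X T {U, V}" .
  qed
qed

theorem corollary3p2:
  fixes X :: "'a topology"
  assumes "compact_space X" and "metrizable_space X"
  shows "\<forall>m. mtopology_of m = X \<longrightarrow> UPE X \<in> sets (borel_of (TDS_topology X m))"
proof (intro allI impI)
  fix m :: "'a metric"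
  assume m: "mtopology_of m = X"
  let ?M = "borel_of (TDS_topology X m)"
  have space: "space ?M = TDS X"
    using topspace_TDS_topology[OF assms(1) m] by (simp add: space_borel_of)
  obtain \<F> where \<F>: "countable \<F>" "\<And>F. F \<in> \<F> \<Longrightarrow> closedin X F"
      "\<And>F. F \<in> \<F> \<Longrightarrow> X interior_of F \<noteq> {}"
      "\<And>A. openin X A \<Longrightarrow> A \<noteq> {} \<Longrightarrow> \<exists>F\<in>\<F>. F \<subseteq> A"
    using countable_closed_pi_base[OF assms] by blast
  define C where "C = {(F, G) \<in> \<F> \<times> \<F>. F \<inter> G = {}}"
  have "countable C"
    unfolding C_def using \<F>(1) by (intro countable_subset[OF _ countable_SIGMA[of \<F> "\<lambda>_. \<F>"]]) auto
  have "{T \<in> space ?M. 0 < h_top X T {topspace X - fst p, topspace X - snd p}} \<in> sets ?M"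
    if "p \<in> C" for p
  proof -
    have "open_cover X {topspace X - fst p, topspace X - snd p}"
      using that \<F>(2) by (auto simp: C_def open_cover_def)
    then have [measurable]:
      "(\<lambda>T. h_top X T {topspace X - fst p, topspace X - snd p}) \<in> borel_measurable ?M"
      by (intro borel_measurable_h_top assms m) simp_all
    show ?thesis
      by measurable
  qed
  then have "{T \<in> space ?M. \<forall>p\<in>C. 0 < h_top X T {topspace X - fst p, topspace X - snd p}} \<in> sets ?M"
    using \<open>countable C\<close> by (intro sets.sets_Collect_countable_All')
  also have "{T \<in> space ?M. \<forall>p\<in>C. 0 < h_top X T {topspace X - fst p, topspace X - snd p}} = UPE X"
    unfolding UPE_def space C_def using has_UPE_iff_pi_base[OF \<F>(2-4)]
    by (auto simp: case_prod_unfold)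
  finally show "UPE X \<in> sets ?M" .
qed

end
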